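(* Let $\mathcal P$ and $\mathcal P_\epsilon$ be Markov kernels on a Polish space $\mathbf X$ and let $V:\mathbf X\to[0,\infty)$ be measurable. Suppose: (i) there are $\gamma\in(0,1)$ and $K>0$ with $(\mathcal P V)(x)\le \gamma V(x)+K$ for all $x\in\mathbf X$; (ii) for every $R>0$ there exists $\bar\alpha_0\in(0,1)$ (depending on $R$) such that $\sup_{x,y:\,V(x)\le R,\,V(y)\le R} d_0(\delta_x\mathcal P,\delta_y\mathcal P)\le 2\bar\alpha_0$; (iii) for some $\epsilon>0$ and $\delta\ge 0$, $d_1(\delta_x\mathcal P,\delta_x\mathcal P_\epsilon)\le \epsilon(1+\delta V(x))$ for all $x\in\mathbf X$. Then there exist $\beta\in(0,1]$ and $\bar\alpha\in(0,1)$ such that for all $x,y\in\mathbf X$ and all measurable $\varphi:\mathbf X\to\mathbb R$ with $|\varphi|\le 1+\beta V$, $$\mathcal P_\epsilon\varphi(x)-\mathcal P\varphi(y)\le \epsilon(1+\delta V(x))+\bar\alpha\, d_\beta(x,y).$$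
   Context: For a Markov kernel $\mathcal P$: $(\mathcal P\varphi)(x)=\int\varphi(y)\,\mathcal P(x,dy)$ and $(\mu\mathcal P)(A)=\int\mathcal P(x,A)\,\mu(dx)$; so $\delta_x\mathcal P=\mathcal P(x,\cdot)$. For $\beta\ge 0$, on points, $d_\beta(x,y)=0$ if $x=y$ and $d_\beta(x,y)=2+\beta V(x)+\beta V(y)$ if $x\ne y$. On probability measures, $d_\beta(\mu,\nu)=\int_{\mathbf X}(1+\beta V(x))\,|\mu-\nu|(dx)$ (weighted total variation), equivalently the supremum of $\int\varphi\,d(\mu-\nu)$ over measurable $\varphi$ with $|\varphi|\le 1+\beta V$. In particular $d_0$ is the total variation metric normalized so that $d_0(\mu,\nu)=|\mu-\nu|(\mathbf X)\in[0,2]$, and $d_1$ is $d_\beta$ with $\beta=1$. *)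

theory Defs
  imports "HOL-Probability.Probability"
begin

text \<open>
  The total variation measure $|\mu-\nu|$ of the difference of two finite measures on the same
  measurable space: $|\mu-\nu|(A)$ is the supremum of $\sum_{B \in Q} |\mu(B)-\nu(B)|$ over the
  finite measurable partitions $Q$ of $A$.
\<close>

definition tv_measure :: "'a measure \<Rightarrow> 'a measure \<Rightarrow> 'a measure" where
  "tv_measure M N = measure_of (space M) (sets M)
     (\<lambda>A. SUP Q\<in>{Q. finite Q \<and> Q \<subseteq> sets M \<and> partition_on A Q}.
            \<Sum>B\<in>Q. ennreal \<bar>measure M B - measure N B\<bar>)"

lemma space_tv_measure [simp]: "space (tv_measure M N) = space M"
  and sets_tv_measure [simp, measurable_cong]: "sets (tv_measure M N) = sets M"
  by (simp_all add: tv_measure_def)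

lemma tv_partition_sup_eq:
  fixes M N :: "'a measure"
  assumes "finite_measure M" "finite_measure N" and sets_eq: "sets N = sets M"
    and Y: "Y \<in> sets M"
    and pos: "\<And>X. X \<in> sets M \<Longrightarrow> X \<subseteq> Y \<Longrightarrow> measure N X \<le> measure M X"
    and neg: "\<And>X. X \<in> sets M \<Longrightarrow> X \<inter> Y = {} \<Longrightarrow> measure M X \<le> measure N X"
    and A: "A \<in> sets M"
  shows "(SUP Q\<in>{Q. finite Q \<and> Q \<subseteq> sets M \<and> partition_on A Q}.
            \<Sum>B\<in>Q. ennreal \<bar>measure M B - measure N B\<bar>)
    = ennreal ((measure M (A \<inter> Y) - measure N (A \<inter> Y)) + (measure N (A - Y) - measure M (A - Y)))"
    (is "(SUP Q\<in>?P. ?s Q) = ennreal (?f A)")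
proof (rule antisym)
  interpret M: finite_measure M by fact
  interpret N: finite_measure N by fact
  have split: "measure M B = measure M (B \<inter> Y) + measure M (B - Y)"
      "measure N B = measure N (B \<inter> Y) + measure N (B - Y)" if "B \<in> sets M" for B
    using M.finite_measure_Diff' [of B Y] N.finite_measure_Diff' [of B Y] that Y sets_eq by auto
  have nn: "0 \<le> measure M (B \<inter> Y) - measure N (B \<inter> Y)"
      "0 \<le> measure N (B - Y) - measure M (B - Y)" if "B \<in> sets M" for B
    using pos[of "B \<inter> Y"] neg[of "B - Y"] that Y by auto
  show "(SUP Q\<in>?P. ?s Q) \<le> ennreal (?f A)"
  proof (rule SUP_least)
    fix Q assume Q: "Q \<in> ?P"
    then have fin: "finite Q" and QM: "Q \<subseteq> sets M" and UQ: "\<Union>Q = A"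
      and dis: "disjoint_family_on (\<lambda>B. B) Q"
      by (auto simp: partition_on_def disjoint_family_on_def disjoint_def)
    have sumM: "measure M (A \<inter> Z) = (\<Sum>B\<in>Q. measure M (B \<inter> Z))" if "Z \<in> sets M" for Z
    proof -
      have "measure M (\<Union>B\<in>Q. B \<inter> Z) = (\<Sum>B\<in>Q. measure M (B \<inter> Z))"
        using fin QM that dis by (intro M.finite_measure_finite_Union) (auto simp: disjoint_family_on_def)
      then show ?thesis using UQ by (metis Int_Union2)
    qed
    have sumN: "measure N (A \<inter> Z) = (\<Sum>B\<in>Q. measure N (B \<inter> Z))" if "Z \<in> sets M" for Z
    proof -
      have "measure N (\<Union>B\<in>Q. B \<inter> Z) = (\<Sum>B\<in>Q. measure N (B \<inter> Z))"
        using fin QM that dis sets_eq by (intro N.finite_measure_finite_Union) (auto simp: disjoint_family_on_def)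
      then show ?thesis using UQ by (metis Int_Union2)
    qed
    have sp: "A - Y = A \<inter> (space M - Y)" "\<And>B. B \<in> Q \<Longrightarrow> B - Y = B \<inter> (space M - Y)"
      using A QM sets.sets_into_space by blast+
    have "?s Q = ennreal (\<Sum>B\<in>Q. \<bar>measure M B - measure N B\<bar>)"
      by (simp add: sum_ennreal)
    also have "\<dots> \<le> ennreal (\<Sum>B\<in>Q. ?f B)"
    proof (intro ennreal_leI sum_mono)
      fix B assume "B \<in> Q"
      then have "B \<in> sets M" using QM by auto
      then show "\<bar>measure M B - measure N B\<bar> \<le> ?f B"
        using split[of B] nn[of B] by linarith
    qed
    also have "(\<Sum>B\<in>Q. ?f B) = ?f A"
      using Y by (simp add: sp sumM sumN sum.distrib sum_subtractf)
    finally show "?s Q \<le> ennreal (?f A)" .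
  qed
  show "ennreal (?f A) \<le> (SUP Q\<in>?P. ?s Q)"
  proof -
    let ?Q = "{A \<inter> Y, A - Y} - {{}}"
    have QP: "?Q \<in> ?P"
      using A Y by (auto simp: partition_on_def disjoint_def)
    have "?s ?Q = (\<Sum>B\<in>{A \<inter> Y, A - Y}. ennreal \<bar>measure M B - measure N B\<bar>)"
      by (rule sum.mono_neutral_left) auto
    also have "\<dots> = ennreal (?f A)"
    proof (cases "A \<inter> Y = A - Y")
      case True
      then have "A = {}" by auto
      then show ?thesis by simp
    next
      case False
      then show ?thesis using nn[OF A] by (simp flip: ennreal_plus)
    qed
    finally show ?thesis using SUP_upper[OF QP, of ?s] by simp
  qed
qed

text \<open>
  For finite measures the partition supremum is countably additive, so the construction by
  \<^const>\<open>measure_of\<close> does not fall back to the zero measure.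
\<close>

lemma emeasure_tv_measure:
  assumes "finite_measure M" "finite_measure N" and sets_eq: "sets N = sets M"
    and A: "A \<in> sets M"
  shows "emeasure (tv_measure M N) A =
     (SUP Q\<in>{Q. finite Q \<and> Q \<subseteq> sets M \<and> partition_on A Q}.
        \<Sum>B\<in>Q. ennreal \<bar>measure M B - measure N B\<bar>)"
proof -
  interpret M: finite_measure M by fact
  interpret N: finite_measure N by fact
  have "\<exists>Y\<in>sets M. (\<forall>X\<in>sets M. X \<subseteq> Y \<longrightarrow> N X \<le> M X) \<and> (\<forall>X\<in>sets M. X \<inter> Y = {} \<longrightarrow> M X \<le> N X)"
    by (rule finite_unsigned_Hahn_decomposition) fact+
  then obtain Y where Y: "Y \<in> sets M"
    and pos: "\<And>X. X \<in> sets M \<Longrightarrow> X \<subseteq> Y \<Longrightarrow> measure N X \<le> measure M X"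
    and neg: "\<And>X. X \<in> sets M \<Longrightarrow> X \<inter> Y = {} \<Longrightarrow> measure M X \<le> measure N X"
    by (auto simp: M.emeasure_eq_measure N.emeasure_eq_measure)
  let ?f = "\<lambda>A. (measure M (A \<inter> Y) - measure N (A \<inter> Y)) + (measure N (A - Y) - measure M (A - Y))"
  let ?m = "\<lambda>A. SUP Q\<in>{Q. finite Q \<and> Q \<subseteq> sets M \<and> partition_on A Q}.
        \<Sum>B\<in>Q. ennreal \<bar>measure M B - measure N B\<bar>"
  have m: "?m B = ennreal (?f B)" if "B \<in> sets M" for B
    by (rule tv_partition_sup_eq) (use assms Y pos neg that in auto)
  have fnn: "0 \<le> ?f B" if "B \<in> sets M" for B
  proof -
    have "(B - Y) \<inter> Y = {}" by blast
    then show ?thesis using pos[of "B \<inter> Y"] neg[of "B - Y"] that Y by auto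
  qed
  have "countably_additive (sets M) ?m"
  proof (rule countably_additiveI)
    fix F :: "nat \<Rightarrow> 'a set"
    assume F: "range F \<subseteq> sets M" "disjoint_family F" "(\<Union>i. F i) \<in> sets M"
    have dis: "disjoint_family (\<lambda>i. F i \<inter> Y)" "disjoint_family (\<lambda>i. F i - Y)"
      using F(2) by (auto simp: disjoint_family_on_def)
    have eq: "(\<Union>i. F i) \<inter> Y = (\<Union>i. F i \<inter> Y)" "(\<Union>i. F i) - Y = (\<Union>i. F i - Y)" by auto
    have "(\<lambda>i. ?f (F i)) sums ?f (\<Union>i. F i)"
      unfolding eq using F(1) Y dis sets_eq
      by (intro sums_add sums_diff M.finite_measure_UNION N.finite_measure_UNION) auto
    then have "(\<Sum>i. ennreal (?f (F i))) = ennreal (?f (\<Union>i. F i))"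
      using F(1) by (intro suminf_ennreal_eq fnn) auto
    moreover have "(\<lambda>i. ?m (F i)) = (\<lambda>i. ennreal (?f (F i)))"
      using F(1) by (intro ext m) auto
    ultimately show "(\<Sum>i. ?m (F i)) = ?m (\<Union>i. F i)"
      unfolding m[OF F(3)] by argo
  qed
  moreover have "positive (sets M) ?m"
    unfolding positive_def m[OF sets.empty_sets] by simp
  ultimately show ?thesis
    unfolding tv_measure_def using A by (intro emeasure_measure_of_sigma sets.sigma_algebra_axioms)
qed

definition weighted_tv :: "('a \<Rightarrow> real) \<Rightarrow> real \<Rightarrow> 'a measure \<Rightarrow> 'a measure \<Rightarrow> ennreal" where
  "weighted_tv V \<beta> \<mu> \<nu> = (\<integral>\<^sup>+x. ennreal (1 + \<beta> * V x) \<partial>tv_measure \<mu> \<nu>)"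

definition point_dist :: "('a \<Rightarrow> real) \<Rightarrow> real \<Rightarrow> 'a \<Rightarrow> 'a \<Rightarrow> real" where
  "point_dist V \<beta> x y = (if x = y then 0 else 2 + \<beta> * V x + \<beta> * V y)"

end

theory Submission
  imports Defs
begin

text \<open>
  The difference splits as
  \[ \mathcal P_\epsilon\varphi(x)-\mathcal P\varphi(y)
     = \bigl(\mathcal P_\epsilon\varphi(x)-\mathcal P\varphi(x)\bigr)
     + \bigl(\mathcal P\varphi(x)-\mathcal P\varphi(y)\bigr). \]
  Because $\beta\le 1$, the first bracket is tested against a function bounded by $1+V$, so duality
  (\<open>integral_diff_le_weighted_tv\<close>) bounds it by the size of the perturbation. The second bracket
  is the weighted Harris theorem for $\mathcal P$ alone (\<open>harris_contraction\<close>).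

  The Harris theorem balances two effects. If $V(x)+V(y)$ is large, the drift condition makes the
  trivial bound $2+\beta\,(\mathcal PV(x)+\mathcal PV(y))$ smaller than $d_\beta(x,y)$ by a definite
  factor. If it is small, both points lie in a sublevel set of $V$, where the local contraction
  shrinks the constant $2$ to $2\bar\alpha_0$. The weight $\beta V$ may then expand, but its
  contribution is at most a constant times $\beta$, and $\beta$ is chosen so small that the gap $1-\bar\alpha_0$
  absorbs it.

  All that is used of the variation measure are the inequalities $\mu\le\nu+|\mu-\nu|$ and
  $\nu\le\mu+|\mu-\nu|$. They yield the duality bound directly: one of them is applied to
  the positive and the other to the negative part of the test function. They also carry the
  integrability of $V$ from $\mathcal P(x,\cdot)$ over to $\mathcal P_\epsilon(x,\cdot)$.
\<close>

section \<open>Duality for the variation measure\<close>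

lemma nn_integral_le_add_measures:
  assumes sets: "sets M = sets L" "sets N = sets L"
    and le: "\<And>A. A \<in> sets L \<Longrightarrow> emeasure L A \<le> emeasure M A + emeasure N A"
    and f: "f \<in> borel_measurable L"
  shows "(\<integral>\<^sup>+x. f x \<partial>L) \<le> (\<integral>\<^sup>+x. f x \<partial>M) + (\<integral>\<^sup>+x. f x \<partial>N)"
proof -
  have meas: "borel_measurable M = borel_measurable L" "borel_measurable N = borel_measurable L"
    using sets by (auto intro: measurable_cong_sets)
  from f show ?thesis
  proof (induction rule: borel_measurable_induct)
    case (cong f g)
    have "space M = space L" "space N = space L"
      using sets by (auto dest: sets_eq_imp_space_eq)
    with cong(3) have "(\<integral>\<^sup>+x. f x \<partial>M) = (\<integral>\<^sup>+x. g x \<partial>M)" "(\<integral>\<^sup>+x. f x \<partial>N) = (\<integral>\<^sup>+x. g x \<partial>N)"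
        "(\<integral>\<^sup>+x. f x \<partial>L) = (\<integral>\<^sup>+x. g x \<partial>L)"
      by (auto intro: nn_integral_cong)
    with cong(4) show ?case by simp
  next
    case (set A)
    then show ?case using le sets by simp
  next
    case (mult u c)
    then show ?case
      using mult_left_mono[OF mult(4), of c]
      by (simp add: nn_integral_cmult meas distrib_left)
  next
    case (add u v)
    then show ?case
      using add_mono[OF add.IH]
      by (simp add: nn_integral_add meas ac_simps)
  next
    case (seq U)
    have "(\<integral>\<^sup>+x. (SUP i. U i x) \<partial>L) = (SUP i. \<integral>\<^sup>+x. U i x \<partial>L)"
      by (intro nn_integral_monotone_convergence_SUP) (use seq in auto)
    also have "\<dots> \<le> (\<integral>\<^sup>+x. (SUP i. U i x) \<partial>M) + (\<integral>\<^sup>+x. (SUP i. U i x) \<partial>N)"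
      by (intro SUP_least order.trans[OF seq.IH] add_mono nn_integral_mono SUP_upper) auto
    finally show ?case
      by (simp add: SUP_apply[abs_def] image_comp)
  qed
qed

text \<open>
  The trivial partition of \<^term>\<open>A\<close> already contributes $|\mu(A)-\nu(A)|$ to the supremum that
  defines $|\mu-\nu|(A)$.
\<close>

lemma emeasure_le_add_tv_measure:
  assumes "finite_measure M" "finite_measure N" and sets_eq: "sets N = sets M"
    and A: "A \<in> sets M"
  shows "emeasure M A \<le> emeasure N A + emeasure (tv_measure M N) A"
    and "emeasure N A \<le> emeasure M A + emeasure (tv_measure M N) A"
proof -
  interpret M: finite_measure M by fact
  interpret N: finite_measure N by fact
  let ?P = "{Q. finite Q \<and> Q \<subseteq> sets M \<and> partition_on A Q}"
  have tv: "ennreal \<bar>measure M A - measure N A\<bar> \<le> emeasure (tv_measure M N) A"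
  proof (cases "A = {}")
    case False
    then have "{A} \<in> ?P" using A by (auto simp: partition_on_def)
    from SUP_upper[OF this, of "\<lambda>Q. \<Sum>B\<in>Q. ennreal \<bar>measure M B - measure N B\<bar>"]
    show ?thesis using assms by (simp add: emeasure_tv_measure)
  qed simp
  have "emeasure M A \<le> emeasure N A + ennreal \<bar>measure M A - measure N A\<bar>"
    by (simp add: M.emeasure_eq_measure N.emeasure_eq_measure flip: ennreal_plus)
  also have "\<dots> \<le> emeasure N A + emeasure (tv_measure M N) A"
    using tv by (rule add_left_mono)
  finally show "emeasure M A \<le> emeasure N A + emeasure (tv_measure M N) A" .
  have "emeasure N A \<le> emeasure M A + ennreal \<bar>measure M A - measure N A\<bar>"
    by (simp add: M.emeasure_eq_measure N.emeasure_eq_measure flip: ennreal_plus)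
  also have "\<dots> \<le> emeasure M A + emeasure (tv_measure M N) A"
    using tv by (rule add_left_mono)
  finally show "emeasure N A \<le> emeasure M A + emeasure (tv_measure M N) A" .
qed

lemma nn_integral_le_add_tv_measure:
  assumes "finite_measure M" "finite_measure N" and sets_eq: "sets N = sets M"
    and f: "f \<in> borel_measurable M"
  shows "(\<integral>\<^sup>+x. f x \<partial>M) \<le> (\<integral>\<^sup>+x. f x \<partial>N) + (\<integral>\<^sup>+x. f x \<partial>tv_measure M N)"
    and "(\<integral>\<^sup>+x. f x \<partial>N) \<le> (\<integral>\<^sup>+x. f x \<partial>M) + (\<integral>\<^sup>+x. f x \<partial>tv_measure M N)"
proof -
  have fN: "f \<in> borel_measurable N"
    using f measurable_cong_sets[OF sets_eq refl] by blast
  show "(\<integral>\<^sup>+x. f x \<partial>M) \<le> (\<integral>\<^sup>+x. f x \<partial>N) + (\<integral>\<^sup>+x. f x \<partial>tv_measure M N)"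
    by (rule nn_integral_le_add_measures[OF _ _ _ f])
       (use emeasure_le_add_tv_measure(1)[OF assms(1,2,3)] sets_eq in auto)
  show "(\<integral>\<^sup>+x. f x \<partial>N) \<le> (\<integral>\<^sup>+x. f x \<partial>M) + (\<integral>\<^sup>+x. f x \<partial>tv_measure M N)"
    by (rule nn_integral_le_add_measures[OF _ _ _ fN])
       (use emeasure_le_add_tv_measure(2)[OF assms(1,2,3)] sets_eq in auto)
qed

text \<open>
  With $\varphi=\varphi^+-\varphi^-$, the difference of the integrals is
  $(\int\varphi^+d\mu-\int\varphi^+d\nu)+(\int\varphi^-d\nu-\int\varphi^-d\mu)$, and the two
  brackets are at most $\int\varphi^+d|\mu-\nu|$ and $\int\varphi^-d|\mu-\nu|$.
\<close>

lemma integral_diff_le_nn_integral_tv_measure: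
  fixes \<phi> :: "'a \<Rightarrow> real"
  assumes "finite_measure M" "finite_measure N" and sets_eq: "sets N = sets M"
    and iM: "integrable M \<phi>" and iN: "integrable N \<phi>"
  shows "ennreal ((\<integral>x. \<phi> x \<partial>M) - (\<integral>x. \<phi> x \<partial>N)) \<le> (\<integral>\<^sup>+x. ennreal \<bar>\<phi> x\<bar> \<partial>tv_measure M N)"
proof -
  let ?p = "\<lambda>x. max 0 (\<phi> x)" and ?m = "\<lambda>x. max 0 (- \<phi> x)"
  let ?T = "tv_measure M N"
  have [measurable]: "\<phi> \<in> borel_measurable M" using iM by simp
  have ip: "integrable L ?p \<and> integrable L ?m" if "integrable L \<phi>" for L :: "'a measure"
    using that by auto
  have int: "(\<integral>x. \<phi> x \<partial>L) = (\<integral>x. ?p x \<partial>L) - (\<integral>x. ?m x \<partial>L)" if "integrable L \<phi>" for L :: "'a measure"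
  proof -
    have "(\<integral>x. \<phi> x \<partial>L) = (\<integral>x. ?p x - ?m x \<partial>L)"
      by (intro Bochner_Integration.integral_cong) auto
    then show ?thesis using ip[OF that] by simp
  qed
  have nn: "(\<integral>\<^sup>+x. ennreal (?p x) \<partial>L) = ennreal (\<integral>x. ?p x \<partial>L)"
      "(\<integral>\<^sup>+x. ennreal (?m x) \<partial>L) = ennreal (\<integral>x. ?m x \<partial>L)" if "integrable L \<phi>" for L :: "'a measure"
    using ip[OF that] by (auto intro!: nn_integral_eq_integral simp del: ennreal_max_0 ennreal_max_0')
  have pos: "0 \<le> (\<integral>x. ?p x \<partial>L)" "0 \<le> (\<integral>x. ?m x \<partial>L)" for L :: "'a measure"
    by (auto intro!: integral_nonneg_AE)
  have pM: "ennreal (\<integral>x. ?p x \<partial>M) \<le> ennreal (\<integral>x. ?p x \<partial>N) + (\<integral>\<^sup>+x. ennreal (?p x) \<partial>?T)"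
    using nn_integral_le_add_tv_measure(1)[OF assms(1,2,3), of "\<lambda>x. ennreal (?p x)"] nn iM iN by simp
  have mN: "ennreal (\<integral>x. ?m x \<partial>N) \<le> ennreal (\<integral>x. ?m x \<partial>M) + (\<integral>\<^sup>+x. ennreal (?m x) \<partial>?T)"
    using nn_integral_le_add_tv_measure(2)[OF assms(1,2,3), of "\<lambda>x. ennreal (?m x)"] nn iM iN by simp
  have abs: "(\<integral>\<^sup>+x. ennreal \<bar>\<phi> x\<bar> \<partial>?T)
      = (\<integral>\<^sup>+x. ennreal (?p x) \<partial>?T) + (\<integral>\<^sup>+x. ennreal (?m x) \<partial>?T)"
  proof -
    have "(\<integral>\<^sup>+x. ennreal \<bar>\<phi> x\<bar> \<partial>?T) = (\<integral>\<^sup>+x. ennreal (?p x) + ennreal (?m x) \<partial>?T)"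
      by (intro nn_integral_cong) (auto simp: max_def simp flip: ennreal_plus)
    then show ?thesis by (simp add: nn_integral_add)
  qed
  have "ennreal (\<integral>x. ?p x \<partial>M) + ennreal (\<integral>x. ?m x \<partial>N)
      \<le> ennreal (\<integral>x. ?p x \<partial>N) + ennreal (\<integral>x. ?m x \<partial>M) + (\<integral>\<^sup>+x. ennreal \<bar>\<phi> x\<bar> \<partial>?T)"
    using add_mono[OF pM mN] unfolding abs by (simp add: ac_simps)
  then show ?thesis
    unfolding int[OF iM] int[OF iN]
    by (cases "\<integral>\<^sup>+x. ennreal \<bar>\<phi> x\<bar> \<partial>?T")
       (auto simp: pos top_unique simp flip: ennreal_plus)
qed

lemma integral_diff_le_weighted_tv:
  fixes \<phi> :: "'a \<Rightarrow> real"
  assumes "finite_measure M" "finite_measure N" "sets N = sets M"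
    and "integrable M \<phi>" "integrable N \<phi>"
    and bound: "\<And>x. \<bar>\<phi> x\<bar> \<le> 1 + \<beta> * V x"
    and tv: "weighted_tv V \<beta> M N \<le> ennreal c" and c: "0 \<le> c"
  shows "(\<integral>x. \<phi> x \<partial>M) - (\<integral>x. \<phi> x \<partial>N) \<le> c"
proof -
  have "ennreal ((\<integral>x. \<phi> x \<partial>M) - (\<integral>x. \<phi> x \<partial>N)) \<le> (\<integral>\<^sup>+x. ennreal \<bar>\<phi> x\<bar> \<partial>tv_measure M N)"
    by (rule integral_diff_le_nn_integral_tv_measure) fact+
  also have "\<dots> \<le> weighted_tv V \<beta> M N"
    unfolding weighted_tv_def by (intro nn_integral_mono ennreal_leI bound)
  also note tv
  finally show ?thesis using c by simp
qed

section \<open>The weighted Harris contraction\<close>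

lemma integrable_if_le_weight:
  fixes \<phi> V :: "'a \<Rightarrow> real"
  assumes "finite_measure M" and V: "integrable M V" and \<phi>: "\<phi> \<in> borel_measurable M"
    and bound: "\<And>x. \<bar>\<phi> x\<bar> \<le> a + b * V x"
  shows "integrable M \<phi>"
proof -
  interpret finite_measure M by fact
  have "integrable M (\<lambda>x. a + b * V x)" using V by simp
  then show ?thesis
    by (rule Bochner_Integration.integrable_bound[OF _ \<phi>])
       (use bound order.trans[OF _ abs_ge_self] in auto)
qed

lemma (in prob_space) abs_integral_le_weight:
  fixes \<phi> V :: "'a \<Rightarrow> real"
  assumes V: "integrable M V" and \<phi>: "\<phi> \<in> borel_measurable M"
    and bound: "\<And>x. \<bar>\<phi> x\<bar> \<le> a + b * V x"
  shows "\<bar>\<integral>x. \<phi> x \<partial>M\<bar> \<le> a + b * (\<integral>x. V x \<partial>M)"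
proof -
  have "integrable M \<phi>"
    by (rule integrable_if_le_weight[OF finite_measure_axioms V \<phi> bound])
  then have "\<bar>\<integral>x. \<phi> x \<partial>M\<bar> \<le> (\<integral>x. a + b * V x \<partial>M)"
    using V bound by (intro order.trans[OF integral_abs_bound] integral_mono) auto
  then show ?thesis using V by (simp add: prob_space)
qed

text \<open>
  The test function is cut at height $1$: the truncation only sees the unweighted total variation
  distance, and the remainder is bounded by $\beta V$.
\<close>

lemma integral_diff_le_truncation:
  fixes \<phi> V :: "'a \<Rightarrow> real"
  assumes "prob_space M" "prob_space N" and sets_eq: "sets N = sets M"
    and VM: "integrable M V" and VN: "integrable N V"
    and \<phi>: "\<phi> \<in> borel_measurable M" and V: "\<And>x. 0 \<le> V x" and \<beta>: "0 \<le> \<beta>"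
    and bound: "\<And>x. \<bar>\<phi> x\<bar> \<le> 1 + \<beta> * V x"
    and tv: "weighted_tv V 0 M N \<le> ennreal c" and c: "0 \<le> c"
  shows "(\<integral>x. \<phi> x \<partial>M) - (\<integral>x. \<phi> x \<partial>N) \<le> c + \<beta> * ((\<integral>x. V x \<partial>M) + (\<integral>x. V x \<partial>N))"
proof -
  interpret M: prob_space M by fact
  interpret N: prob_space N by fact
  have [measurable]: "\<phi> \<in> borel_measurable M" "\<phi> \<in> borel_measurable N"
    using \<phi> measurable_cong_sets[OF sets_eq refl] by auto
  define f where "f x = max (-1) (min 1 (\<phi> x))" for x
  define g where "g x = \<phi> x - f x" for x
  have [measurable]: "f \<in> borel_measurable M" "f \<in> borel_measurable N"
      "g \<in> borel_measurable M" "g \<in> borel_measurable N"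
    unfolding f_def[abs_def] g_def[abs_def] by auto
  have f: "\<bar>f x\<bar> \<le> 1 + 0 * V x" for x by (auto simp: f_def)
  have g: "\<bar>g x\<bar> \<le> 0 + \<beta> * V x" for x
    using bound[of x] mult_nonneg_nonneg[OF \<beta> V[of x]] by (auto simp: g_def f_def max_def min_def abs_if split: if_splits)
  have fi: "integrable M f" "integrable N f"
    by (rule integrable_if_le_weight[OF _ _ _ f] M.finite_measure_axioms N.finite_measure_axioms
        VM VN, measurable)+
  have gi: "integrable M g" "integrable N g"
    by (rule integrable_if_le_weight[OF _ _ _ g] M.finite_measure_axioms N.finite_measure_axioms
        VM VN, measurable)+
  have sum: "(\<integral>x. \<phi> x \<partial>M) = (\<integral>x. f x \<partial>M) + (\<integral>x. g x \<partial>M)"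
      "(\<integral>x. \<phi> x \<partial>N) = (\<integral>x. f x \<partial>N) + (\<integral>x. g x \<partial>N)"
    by (subst Bochner_Integration.integral_add[symmetric]; (rule fi gi)?; simp add: g_def)+
  have "(\<integral>x. f x \<partial>M) - (\<integral>x. f x \<partial>N) \<le> c"
    by (rule integral_diff_le_weighted_tv[OF _ _ sets_eq fi f tv c])
       (rule M.finite_measure_axioms N.finite_measure_axioms)+
  moreover have "\<bar>\<integral>x. g x \<partial>M\<bar> \<le> 0 + \<beta> * (\<integral>x. V x \<partial>M)"
    by (rule M.abs_integral_le_weight[OF VM _ g]) measurable
  moreover have "\<bar>\<integral>x. g x \<partial>N\<bar> \<le> 0 + \<beta> * (\<integral>x. V x \<partial>N)"
    by (rule N.abs_integral_le_weight[OF VN _ g]) measurable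
  ultimately show ?thesis unfolding sum distrib_left by linarith
qed

text \<open>
  The level $R=4K/(1-\gamma)$ solves $\gamma R+2K=R-2K$, so that the drift gains at least
  $2K\beta$ over $2+\beta\,(U(x)+U(y))$ as soon as $U(x)+U(y)\ge R$. The weight $U$ lives on the
  starting points and $V$ on the space where the test functions are defined; a Lyapunov function
  of a kernel from a space to itself plays both parts.
\<close>

lemma harris_contraction:
  fixes P :: "'a \<Rightarrow> 'b measure" and U :: "'a \<Rightarrow> real" and V :: "'b \<Rightarrow> real"
    and \<gamma> K \<alpha>\<^sub>0 :: real
  defines "R \<equiv> 4 * K / (1 - \<gamma>)"
  assumes prob: "\<And>x. prob_space (P x)" and sets: "\<And>x. sets (P x) = sets L"
    and V: "\<And>x. integrable (P x) V" "\<And>z. 0 \<le> V z" and U: "\<And>x. 0 \<le> U x"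
    and \<gamma>: "0 < \<gamma>" "\<gamma> < 1" and K: "0 < K"
    and drift: "\<And>x. (\<integral>z. V z \<partial>P x) \<le> \<gamma> * U x + K"
    and \<alpha>\<^sub>0: "0 < \<alpha>\<^sub>0" "\<alpha>\<^sub>0 < 1"
    and small: "\<And>x y. U x \<le> R \<Longrightarrow> U y \<le> R \<Longrightarrow> weighted_tv V 0 (P x) (P y) \<le> ennreal (2 * \<alpha>\<^sub>0)"
  shows "\<exists>\<beta> \<alpha>::real. 0 < \<beta> \<and> \<beta> \<le> 1 \<and> 0 < \<alpha> \<and> \<alpha> < 1 \<and>
    (\<forall>x y. \<forall>\<phi>\<in>borel_measurable L. (\<forall>z. \<bar>\<phi> z\<bar> \<le> 1 + \<beta> * V z) \<longrightarrow>
       (\<integral>z. \<phi> z \<partial>P x) - (\<integral>z. \<phi> z \<partial>P y) \<le> \<alpha> * point_dist U \<beta> x y)"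
proof -
  have R: "0 < R" and R_eq: "\<gamma> * R + 2 * K = R - 2 * K"
    using \<gamma> K by (auto simp: R_def field_simps)
  \<comment> \<open>On the sublevel set the weight contributes at most \<open>\<beta> * R\<close>, which has to stay within half
    of the gap \<open>2 - 2 * \<alpha>\<^sub>0\<close>.\<close>
  define \<beta> where "\<beta> = min 1 ((1 - \<alpha>\<^sub>0) / R)"
  have \<beta>: "0 < \<beta>" "\<beta> \<le> 1" using R \<alpha>\<^sub>0 by (auto simp: \<beta>_def)
  have \<beta>R: "\<beta> * R \<le> 1 - \<alpha>\<^sub>0"
    using R unfolding \<beta>_def by (metis min.cobounded2 pos_le_divide_eq)
  define \<alpha>\<^sub>1 where "\<alpha>\<^sub>1 = (2 + \<beta> * (R - 2 * K)) / (2 + \<beta> * R)"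
  define \<alpha> where "\<alpha> = max \<alpha>\<^sub>1 ((1 + \<alpha>\<^sub>0) / 2)"
  have den: "0 < 2 + \<beta> * R" using \<beta> R by (simp add: add_pos_pos)
  have \<alpha>1: "\<alpha>\<^sub>1 * (2 + \<beta> * R) = 2 + \<beta> * (R - 2 * K)" using den by (simp add: \<alpha>\<^sub>1_def)
  have "\<alpha>\<^sub>1 < 1" using den \<beta> K by (simp add: \<alpha>\<^sub>1_def algebra_simps)
  then have \<alpha>: "0 < \<alpha>" "\<alpha> < 1" using \<alpha>\<^sub>0 by (auto simp: \<alpha>_def less_max_iff_disj)
  have "\<gamma> * (2 + \<beta> * R) \<le> 2 + \<beta> * (R - 2 * K)"
    unfolding R_eq[symmetric] using \<gamma> mult_pos_pos[OF \<beta>(1) K] by (simp add: algebra_simps)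
  then have \<gamma>\<alpha>1: "\<gamma> \<le> \<alpha>\<^sub>1" using den by (simp add: \<alpha>\<^sub>1_def pos_le_divide_eq)
  have "(\<integral>z. \<phi> z \<partial>P x) - (\<integral>z. \<phi> z \<partial>P y) \<le> \<alpha> * point_dist U \<beta> x y"
    if \<phi>: "\<phi> \<in> borel_measurable L" and bound: "\<And>z. \<bar>\<phi> z\<bar> \<le> 1 + \<beta> * V z" for x y \<phi>
  proof (cases "x = y")
    case False
    have \<phi>P: "\<phi> \<in> borel_measurable (P x)" for x
      using \<phi> measurable_cong_sets[OF sets[of x] refl] by auto
    define S where "S = U x + U y"
    have S: "0 \<le> S" "U x \<le> S" "U y \<le> S" using U[of x] U[of y] by (auto simp: S_def)
    have d: "point_dist U \<beta> x y = 2 + \<beta> * S"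
      using False by (simp add: point_dist_def S_def distrib_left)
    have drift2: "\<beta> * ((\<integral>z. V z \<partial>P x) + (\<integral>z. V z \<partial>P y)) \<le> \<beta> * (\<gamma> * S + 2 * K)"
      using drift[of x] drift[of y] \<beta> by (intro mult_left_mono) (auto simp: S_def algebra_simps)
    show ?thesis
    proof (cases "S \<le> R")
      case True
      have "(\<integral>z. \<phi> z \<partial>P x) - (\<integral>z. \<phi> z \<partial>P y)
          \<le> 2 * \<alpha>\<^sub>0 + \<beta> * ((\<integral>z. V z \<partial>P x) + (\<integral>z. V z \<partial>P y))"
        by (rule integral_diff_le_truncation[OF prob prob _ V(1) V(1) \<phi>P V(2) _ bound small])
           (use True S sets \<beta> \<alpha>\<^sub>0 in auto)
      also have "\<dots> \<le> 2 * \<alpha>\<^sub>0 + \<beta> * R"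
      proof -
        have "\<gamma> * S \<le> \<gamma> * R" using True \<gamma> by (intro mult_left_mono) auto
        then have "\<gamma> * S + 2 * K \<le> R" using R_eq K by linarith
        then have "\<beta> * (\<gamma> * S + 2 * K) \<le> \<beta> * R" using \<beta> by (intro mult_left_mono) auto
        then show ?thesis using drift2 by linarith
      qed
      also have "\<dots> \<le> \<alpha> * 2" using \<beta>R by (auto simp: \<alpha>_def max_def)
      also have "\<dots> \<le> \<alpha> * point_dist U \<beta> x y"
        unfolding d using \<alpha> \<beta> S by (intro mult_left_mono) auto
      finally show ?thesis .
    next
      case False
      have "(\<integral>z. \<phi> z \<partial>P x) - (\<integral>z. \<phi> z \<partial>P y)
          \<le> 2 + \<beta> * ((\<integral>z. V z \<partial>P x) + (\<integral>z. V z \<partial>P y))"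
        using prob_space.abs_integral_le_weight[OF prob V(1) \<phi>P bound, of x]
          prob_space.abs_integral_le_weight[OF prob V(1) \<phi>P bound, of y]
        unfolding distrib_left by linarith
      also have "\<dots> \<le> 2 + \<beta> * (\<gamma> * S + 2 * K)" using drift2 by simp
      \<comment> \<open>Both sides are affine in \<open>S\<close> and agree at \<open>S = R\<close>; the slope of the right one is at least as large.\<close>
      also have "\<dots> \<le> \<alpha>\<^sub>1 * (2 + \<beta> * S)"
      proof -
        have "\<gamma> * (\<beta> * (S - R)) \<le> \<alpha>\<^sub>1 * (\<beta> * (S - R))"
          using False \<beta> \<gamma>\<alpha>1 by (intro mult_right_mono) auto
        moreover have "2 + \<beta> * (\<gamma> * S + 2 * K) = 2 + \<beta> * (\<gamma> * R + 2 * K) + \<gamma> * (\<beta> * (S - R))"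
            "\<alpha>\<^sub>1 * (2 + \<beta> * S) = \<alpha>\<^sub>1 * (2 + \<beta> * R) + \<alpha>\<^sub>1 * (\<beta> * (S - R))"
          by (auto simp: algebra_simps)
        ultimately show ?thesis unfolding \<alpha>1 R_eq by linarith
      qed
      also have "\<dots> \<le> \<alpha> * point_dist U \<beta> x y"
        unfolding d using \<beta> S by (intro mult_right_mono) (auto simp: \<alpha>_def)
      finally show ?thesis .
    qed
  qed (simp add: point_dist_def)
  then show ?thesis using \<beta> \<alpha> by blast
qed

section \<open>Contraction up to the perturbation\<close>

theorem theorem1p5:
  fixes P P\<^sub>\<epsilon> :: "'a::polish_space \<Rightarrow> 'a measure"
    and V :: "'a \<Rightarrow> real"
    and \<gamma> K \<epsilon> \<delta> :: real
  assumes P: "P \<in> borel \<rightarrow>\<^sub>M prob_algebra borel"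
    and P\<^sub>\<epsilon>: "P\<^sub>\<epsilon> \<in> borel \<rightarrow>\<^sub>M prob_algebra borel"
    and V_measurable: "V \<in> borel_measurable borel"
    and V_nonneg: "\<And>x. 0 \<le> V x"
    and \<gamma>: "0 < \<gamma>" "\<gamma> < 1"
    and K: "0 < K"
    and lyapunov: "\<And>x. (\<integral>\<^sup>+y. ennreal (V y) \<partial>P x) \<le> ennreal (\<gamma> * V x + K)"
    and local_contraction: "\<And>R::real. 0 < R \<Longrightarrow> \<exists>\<alpha>\<^sub>0::real. 0 < \<alpha>\<^sub>0 \<and> \<alpha>\<^sub>0 < 1 \<and>
        (SUP (x, y)\<in>{(x, y). V x \<le> R \<and> V y \<le> R}. weighted_tv V 0 (P x) (P y)) \<le> ennreal (2 * \<alpha>\<^sub>0)"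
    and \<epsilon>: "0 < \<epsilon>"
    and \<delta>: "0 \<le> \<delta>"
    and perturbation: "\<And>x. weighted_tv V 1 (P x) (P\<^sub>\<epsilon> x) \<le> ennreal (\<epsilon> * (1 + \<delta> * V x))"
  shows "\<exists>\<beta> \<alpha>::real. 0 < \<beta> \<and> \<beta> \<le> 1 \<and> 0 < \<alpha> \<and> \<alpha> < 1 \<and>
    (\<forall>x y. \<forall>\<phi>\<in>borel_measurable borel. (\<forall>z. \<bar>\<phi> z\<bar> \<le> 1 + \<beta> * V z) \<longrightarrow>
       (\<integral>z. \<phi> z \<partial>P\<^sub>\<epsilon> x) - (\<integral>z. \<phi> z \<partial>P y)
         \<le> \<epsilon> * (1 + \<delta> * V x) + \<alpha> * point_dist V \<beta> x y)"
proof -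
  have prob: "prob_space (P x)" "prob_space (P\<^sub>\<epsilon> x)"
    and sets: "sets (P x) = sets borel" "sets (P\<^sub>\<epsilon> x) = sets borel" for x
    using measurable_space[OF P, of x] measurable_space[OF P\<^sub>\<epsilon>, of x]
    by (auto simp: space_prob_algebra)
  have fin: "finite_measure (P x)" "finite_measure (P\<^sub>\<epsilon> x)" for x
    using prob[of x] by (auto simp: prob_space_def)
  have meas: "f \<in> borel_measurable (P x)" "f \<in> borel_measurable (P\<^sub>\<epsilon> x)"
    if "f \<in> borel_measurable borel" for f :: "'a \<Rightarrow> real" and x
    using that measurable_cong_sets[OF sets(1)[of x] refl] measurable_cong_sets[OF sets(2)[of x] refl]
    by auto
  have VP: "integrable (P x) V" for x
    using lyapunov[of x] V_nonneg
    by (intro integrableI_nonneg meas V_measurable) (auto simp: less_top[symmetric] top_unique)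
  have drift: "(\<integral>z. V z \<partial>P x) \<le> \<gamma> * V x + K" for x
  proof -
    have "0 \<le> \<gamma> * V x + K" using V_nonneg[of x] \<gamma> K by simp
    then show ?thesis
      using lyapunov[of x] nn_integral_eq_integral[OF VP[of x]] V_nonneg
      by (simp del: ennreal_plus)
  qed
  have VP\<epsilon>: "integrable (P\<^sub>\<epsilon> x) V" for x
  proof (intro integrableI_nonneg meas V_measurable)
    have "(\<integral>\<^sup>+z. ennreal (V z) \<partial>P\<^sub>\<epsilon> x)
        \<le> (\<integral>\<^sup>+z. ennreal (V z) \<partial>P x) + (\<integral>\<^sup>+z. ennreal (V z) \<partial>tv_measure (P x) (P\<^sub>\<epsilon> x))"
      by (rule nn_integral_le_add_tv_measure(2)[OF fin]) (use sets meas[OF V_measurable] in auto)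
    also have "\<dots> \<le> ennreal (\<gamma> * V x + K) + weighted_tv V 1 (P x) (P\<^sub>\<epsilon> x)"
      unfolding weighted_tv_def by (intro add_mono lyapunov nn_integral_mono ennreal_leI) simp
    also have "\<dots> \<le> ennreal (\<gamma> * V x + K) + ennreal (\<epsilon> * (1 + \<delta> * V x))"
      by (intro add_left_mono perturbation)
    also have "\<dots> < \<infinity>" by simp
    finally show "(\<integral>\<^sup>+z. ennreal (V z) \<partial>P\<^sub>\<epsilon> x) < \<infinity>" .
  qed (use V_nonneg in auto)
  define R where "R = 4 * K / (1 - \<gamma>)"
  have "0 < R" using \<gamma> K by (simp add: R_def)
  from local_contraction[OF this] obtain \<alpha>\<^sub>0 where \<alpha>\<^sub>0: "0 < \<alpha>\<^sub>0" "\<alpha>\<^sub>0 < 1"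
    and sup: "(SUP (x, y)\<in>{(x, y). V x \<le> R \<and> V y \<le> R}. weighted_tv V 0 (P x) (P y)) \<le> ennreal (2 * \<alpha>\<^sub>0)"
    by blast
  have small: "weighted_tv V 0 (P x) (P y) \<le> ennreal (2 * \<alpha>\<^sub>0)" if "V x \<le> R" "V y \<le> R" for x y
    by (rule order.trans[OF _ sup], rule SUP_upper2[of "(x, y)"]) (use that in auto)
  have "\<exists>\<beta> \<alpha>::real. 0 < \<beta> \<and> \<beta> \<le> 1 \<and> 0 < \<alpha> \<and> \<alpha> < 1 \<and>
    (\<forall>x y. \<forall>\<phi>\<in>borel_measurable borel. (\<forall>z. \<bar>\<phi> z\<bar> \<le> 1 + \<beta> * V z) \<longrightarrow>
       (\<integral>z. \<phi> z \<partial>P x) - (\<integral>z. \<phi> z \<partial>P y) \<le> \<alpha> * point_dist V \<beta> x y)"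
    by (rule harris_contraction[OF prob(1) sets(1) VP V_nonneg V_nonneg \<gamma> K drift \<alpha>\<^sub>0
          small[unfolded R_def]])
  then obtain \<beta> \<alpha> :: real where \<beta>: "0 < \<beta>" "\<beta> \<le> 1" and \<alpha>: "0 < \<alpha>" "\<alpha> < 1"
    and contr: "\<forall>x y. \<forall>\<phi>\<in>borel_measurable borel. (\<forall>z. \<bar>\<phi> z\<bar> \<le> 1 + \<beta> * V z) \<longrightarrow>
       (\<integral>z. \<phi> z \<partial>P x) - (\<integral>z. \<phi> z \<partial>P y) \<le> \<alpha> * point_dist V \<beta> x y"
    by blast
  have "(\<integral>z. \<phi> z \<partial>P\<^sub>\<epsilon> x) - (\<integral>z. \<phi> z \<partial>P y) \<le> \<epsilon> * (1 + \<delta> * V x) + \<alpha> * point_dist V \<beta> x y"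
    if \<phi>: "\<phi> \<in> borel_measurable borel" and bound: "\<forall>z. \<bar>\<phi> z\<bar> \<le> 1 + \<beta> * V z" for x y \<phi>
  proof -
    have bound1: "\<bar>\<phi> z\<bar> \<le> 1 + 1 * V z" for z
      using bound mult_right_mono[OF \<beta>(2) V_nonneg[of z]] by (auto intro: order.trans)
    have "integrable (P x) \<phi>" "integrable (P\<^sub>\<epsilon> x) \<phi>"
      using integrable_if_le_weight[OF fin(1) VP meas(1)[OF \<phi>] bound1]
        integrable_if_le_weight[OF fin(2) VP\<epsilon> meas(2)[OF \<phi>] bound1] by auto
    then have "(\<integral>z. - \<phi> z \<partial>P x) - (\<integral>z. - \<phi> z \<partial>P\<^sub>\<epsilon> x) \<le> \<epsilon> * (1 + \<delta> * V x)"
      by (intro integral_diff_le_weighted_tv[OF fin _ _ _ _ perturbation])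
         (use bound1 sets \<epsilon> \<delta> V_nonneg in auto)
    moreover have "(\<integral>z. \<phi> z \<partial>P x) - (\<integral>z. \<phi> z \<partial>P y) \<le> \<alpha> * point_dist V \<beta> x y"
      using contr \<phi> bound by blast
    ultimately show ?thesis by simp
  qed
  then show ?thesis using \<beta> \<alpha> by blast
qed

end
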